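(* Let $G\cong \mathrm{PSL}(2,q)$ with $q=p^f$, where $p$ is an odd prime and $f\ge 1$. Then $\Gamma_S(G)$ is a cograph if and only if $q=3$.
   Context: For a group $G$ with identity $e$, the intersection subgroup graph $\Gamma_S(G)$ is the simple graph whose vertices are the non-trivial subgroups $H$ of $G$ such that $H\cap K=\{e\}$ for some non-trivial subgroup $K$ of $G$; two distinct vertices $H,K$ are adjacent if and only if $H\cap K=\{e\}$. A graph is a cograph if it has no induced subgraph isomorphic to the path $P_4$ on four vertices. *)

theory Defs
  imports
    "HOL-Analysis.Analysis"
    "HOL-Algebra.Algebra"
    "Graph_Theory.Graph_Theory"
begin

section \<open>Special linear and projective special linear groups\<close>

text \<open>
  The field is the type \<open>'k\<close> and the degree is \<open>CARD('n)\<close>; so \<open>PSL :: ('k ^ 2 ^ 2) set monoid\<close>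
  with \<open>CARD('k) = q\<close> is \<open>PSL(2, q)\<close>.
\<close>

definition SL :: "('k::field ^ 'n ^ 'n) monoid" where
  "SL = \<lparr>carrier = {A. det A = 1}, mult = (**), one = mat 1\<rparr>"

definition group_center :: "('a, 'b) monoid_scheme \<Rightarrow> 'a set" where
  "group_center G = {z \<in> carrier G. \<forall>x\<in>carrier G. z \<otimes>\<^bsub>G\<^esub> x = x \<otimes>\<^bsub>G\<^esub> z}"

definition PSL :: "('k::field ^ 'n ^ 'n) set monoid" where
  "PSL = SL Mod group_center SL"

section \<open>Cographs\<close>

text \<open>
  A simple graph is represented, as in \<^theory>\<open>Graph_Theory.Pair_Digraph\<close>, by a
  symmetric irreflexive set of arcs: an edge \<open>{u, v}\<close> is the pair of arcs \<open>(u, v)\<close> and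
  \<open>(v, u)\<close>. Between such graphs, subgraphs induced on a vertex set and isomorphisms in the
  directed sense are those of the underlying undirected graphs.
\<close>

definition P4 :: "nat pair_pre_digraph" where
  "P4 = \<lparr>pverts = {0, 1, 2, 3},
         parcs = {(0, 1), (1, 0), (1, 2), (2, 1), (2, 3), (3, 2)}\<rparr>"

definition cograph :: "'a pair_pre_digraph \<Rightarrow> bool" where
  "cograph \<Gamma> \<longleftrightarrow>
     \<not> (\<exists>H. induced_subgraph H (with_proj \<Gamma>) \<and> digraph_iso H (with_proj P4))"

section \<open>The intersection subgroup graph\<close>

definition nontrivial_subgroup :: "('a, 'b) monoid_scheme \<Rightarrow> 'a set \<Rightarrow> bool" where
  "nontrivial_subgroup G H \<longleftrightarrow> subgroup H G \<and> H \<noteq> {\<one>\<^bsub>G\<^esub>}"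

definition isg_verts :: "('a, 'b) monoid_scheme \<Rightarrow> 'a set set" where
  "isg_verts G =
     {H. nontrivial_subgroup G H \<and> (\<exists>K. nontrivial_subgroup G K \<and> H \<inter> K = {\<one>\<^bsub>G\<^esub>})}"

definition intersection_subgroup_graph ::
    "('a, 'b) monoid_scheme \<Rightarrow> 'a set pair_pre_digraph" where
  "intersection_subgroup_graph G =
     \<lparr>pverts = isg_verts G,
      parcs = {(H, K). H \<in> isg_verts G \<and> K \<in> isg_verts G \<and> H \<noteq> K \<and> H \<inter> K = {\<one>\<^bsub>G\<^esub>}}\<rparr>"

lemma pair_bidirected_P4: "pair_bidirected_digraph P4"
proof
  show "symmetric (with_proj P4)"
    unfolding symmetric_def with_proj_simps P4_def by (rule symI) auto
qed (auto simp: P4_def)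

lemma pair_bidirected_intersection_subgroup_graph:
  "pair_bidirected_digraph (intersection_subgroup_graph G)"
proof
  have "sym (parcs (intersection_subgroup_graph G))"
  proof (rule symI)
    fix H K assume "(H, K) \<in> parcs (intersection_subgroup_graph G)"
    then have "H \<in> isg_verts G" "K \<in> isg_verts G" "H \<noteq> K" "K \<inter> H = {\<one>\<^bsub>G\<^esub>}"
      unfolding intersection_subgroup_graph_def by (simp_all add: Int_commute)
    then show "(K, H) \<in> parcs (intersection_subgroup_graph G)"
      unfolding intersection_subgroup_graph_def by (simp add: eq_commute[of K H])
  qed
  then show "symmetric (with_proj (intersection_subgroup_graph G))"
    unfolding symmetric_def by simp
next
  fix e assume "e \<in> parcs (intersection_subgroup_graph G)"
  then show "fst e \<in> pverts (intersection_subgroup_graph G)"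
    "snd e \<in> pverts (intersection_subgroup_graph G)" "fst e \<noteq> snd e"
    unfolding intersection_subgroup_graph_def by (simp_all add: split_beta)
qed

lemma group_SL: "group (SL :: ('k::field ^ 'n ^ 'n) monoid)"
proof (rule groupI)
  fix A :: "'k ^ 'n ^ 'n" assume "A \<in> carrier SL"
  then have A: "det A = 1" by (simp add: SL_def)
  then obtain B where B: "B ** A = mat 1"
    by (metis invertible_det_nz invertible_left_inverse zero_neq_one)
  have "det B * det A = 1"
    by (metis B det_mul det_I)
  with A B show "\<exists>B\<in>carrier SL. B \<otimes>\<^bsub>SL\<^esub> A = \<one>\<^bsub>SL\<^esub>"
    by (auto simp: SL_def intro!: bexI[of _ B])
qed (auto simp: SL_def det_mul matrix_mul_assoc)

lemma normal_group_center:
  assumes "group G"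
  shows "group_center G \<lhd> G"
proof -
  interpret group G by fact
  have sub: "subgroup (group_center G) G"
  proof (rule subgroupI)
    show "group_center G \<subseteq> carrier G"
      by (auto simp: group_center_def)
    have "\<one>\<^bsub>G\<^esub> \<in> group_center G"
      by (simp add: group_center_def)
    then show "group_center G \<noteq> {}"
      by blast
  next
    fix a assume a: "a \<in> group_center G"
    then have ac: "a \<in> carrier G" by (simp add: group_center_def)
    have "inv\<^bsub>G\<^esub> a \<otimes>\<^bsub>G\<^esub> x = x \<otimes>\<^bsub>G\<^esub> inv\<^bsub>G\<^esub> a" if x: "x \<in> carrier G" for x
    proof -
      have "a \<otimes>\<^bsub>G\<^esub> x = x \<otimes>\<^bsub>G\<^esub> a" using a x by (simp add: group_center_def)
      then have "x = inv\<^bsub>G\<^esub> a \<otimes>\<^bsub>G\<^esub> (x \<otimes>\<^bsub>G\<^esub> a)"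
        using inv_solve_left[OF x ac m_closed[OF x ac]] by simp
      then have "x = (inv\<^bsub>G\<^esub> a \<otimes>\<^bsub>G\<^esub> x) \<otimes>\<^bsub>G\<^esub> a"
        using ac x by (simp add: m_assoc)
      then show ?thesis
        using inv_solve_right[OF m_closed[OF inv_closed[OF ac] x] x ac] by simp
    qed
    with ac show "inv\<^bsub>G\<^esub> a \<in> group_center G" by (simp add: group_center_def)
  next
    fix a b assume ab: "a \<in> group_center G" "b \<in> group_center G"
    then have c: "a \<in> carrier G" "b \<in> carrier G" by (simp_all add: group_center_def)
    have "(a \<otimes>\<^bsub>G\<^esub> b) \<otimes>\<^bsub>G\<^esub> x = x \<otimes>\<^bsub>G\<^esub> (a \<otimes>\<^bsub>G\<^esub> b)" if x: "x \<in> carrier G" for x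
    proof -
      have "(a \<otimes>\<^bsub>G\<^esub> b) \<otimes>\<^bsub>G\<^esub> x = a \<otimes>\<^bsub>G\<^esub> (b \<otimes>\<^bsub>G\<^esub> x)" using c x by (rule m_assoc)
      also have "b \<otimes>\<^bsub>G\<^esub> x = x \<otimes>\<^bsub>G\<^esub> b" using ab x by (simp add: group_center_def)
      also have "a \<otimes>\<^bsub>G\<^esub> (x \<otimes>\<^bsub>G\<^esub> b) = (a \<otimes>\<^bsub>G\<^esub> x) \<otimes>\<^bsub>G\<^esub> b" using c x by (simp add: m_assoc)
      also have "a \<otimes>\<^bsub>G\<^esub> x = x \<otimes>\<^bsub>G\<^esub> a" using ab x by (simp add: group_center_def)
      also have "(x \<otimes>\<^bsub>G\<^esub> a) \<otimes>\<^bsub>G\<^esub> b = x \<otimes>\<^bsub>G\<^esub> (a \<otimes>\<^bsub>G\<^esub> b)" using c x by (simp add: m_assoc)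
      finally show ?thesis .
    qed
    with c show "a \<otimes>\<^bsub>G\<^esub> b \<in> group_center G" by (simp add: group_center_def)
  qed
  show ?thesis
  proof (rule normalI[OF sub], rule ballI)
    fix x assume "x \<in> carrier G"
    then have "h \<otimes>\<^bsub>G\<^esub> x = x \<otimes>\<^bsub>G\<^esub> h" if "h \<in> group_center G" for h
      using that by (simp add: group_center_def)
    then show "group_center G #>\<^bsub>G\<^esub> x = x <#\<^bsub>G\<^esub> group_center G"
      unfolding r_coset_def l_coset_def by simp
  qed
qed

lemma group_PSL: "group (PSL :: ('k::field ^ 'n ^ 'n) set monoid)"
  unfolding PSL_def
  by (rule normal.factorgroup_is_group[OF normal_group_center[OF group_SL]])

end

theory Submission
  imports Defs "HOL-Number_Theory.Residues"
begin

text \<open>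
  For \<open>q > 3\<close> the images in \<open>PSL(2, q)\<close> of the upper triangular, lower unitriangular, upper
  unitriangular and lower triangular matrices form, in this order, an induced path: the two
  triangular groups meet in the image of the diagonal torus, which is nontrivial because the
  field has a nonzero element other than 1 and -1. For \<open>q = 3\<close> the group is the alternating
  group of degree 4. Both ends of an induced path are proper subgroups of non-prime order, and
  the only such nontrivial subgroup is the Klein four-group: a subgroup of order 6 would contain
  all squares, hence all of the 8 elements of order 3. So the ends would coincide.
\<close>

section \<open>Cographs and intersection subgroup graphs\<close>

text \<open>Replaces isomorphisms of digraphs by four named vertices. Arcs are symmetric and
  loop-free, so one orientation of each of the six pairs determines the induced subgraph.\<close>

lemma not_cograph_iff:
  assumes "pair_bidirected_digraph \<Gamma>"
  shows "\<not> cograph \<Gamma> \<longleftrightarrow>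
    (\<exists>a b c d. distinct [a, b, c, d] \<and> {a, b, c, d} \<subseteq> pverts \<Gamma> \<and>
       (a, b) \<in> parcs \<Gamma> \<and> (b, c) \<in> parcs \<Gamma> \<and> (c, d) \<in> parcs \<Gamma> \<and>
       (a, c) \<notin> parcs \<Gamma> \<and> (a, d) \<notin> parcs \<Gamma> \<and> (b, d) \<notin> parcs \<Gamma>)"
    (is "_ \<longleftrightarrow> ?R")
proof
  interpret pair_bidirected_digraph \<Gamma> by fact
  {
    assume "\<not> cograph \<Gamma>"
    then obtain H f where ind: "induced_subgraph H (with_proj \<Gamma>)"
      and f: "pre_digraph.digraph_isomorphism H f" and P4: "with_proj P4 = app_iso f H"
      unfolding cograph_def digraph_iso_def by blast
    from ind have sub: "verts H \<subseteq> pverts \<Gamma>" and comp: "tail H = fst" "head H = snd"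
      and arcs: "arcs H = {e \<in> parcs \<Gamma>. fst e \<in> verts H \<and> snd e \<in> verts H}"
      unfolding induced_subgraph_def subgraph_def compatible_def by auto
    \<comment> \<open>Comparing the \<open>tail\<close> and \<open>head\<close> fields in
      \<open>P4\<close> forces the end maps of \<open>f\<close> to be \<open>fst\<close> and
      \<open>snd\<close>. Hence the arc map is the vertex map applied to both ends.\<close>
    have inj: "inj_on (iso_verts f) (verts H)"
      and ends: "e \<in> arcs H \<Longrightarrow> iso_arcs f e = (iso_verts f (fst e), iso_verts f (snd e))" for e
      using f arg_cong[OF P4, of tail] arg_cong[OF P4, of head]
      unfolding pre_digraph.digraph_isomorphism_def by (auto simp: comp prod_eq_iff)
    have img: "iso_verts f ` verts H = {0, 1, 2, 3}" "iso_arcs f ` arcs H = parcs P4"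
      using arg_cong[OF P4, of verts] arg_cong[OF P4, of arcs] by (auto simp: P4_def)
    have adj: "(u, v) \<in> parcs \<Gamma> \<longleftrightarrow> (iso_verts f u, iso_verts f v) \<in> parcs P4"
      if "u \<in> verts H" "v \<in> verts H" for u v
    proof
      assume "(u, v) \<in> parcs \<Gamma>"
      then have "(u, v) \<in> arcs H" using that arcs by simp
      then show "(iso_verts f u, iso_verts f v) \<in> parcs P4"
        using ends[of "(u, v)"] img(2) by force
    next
      assume "(iso_verts f u, iso_verts f v) \<in> parcs P4"
      then obtain e where e: "e \<in> arcs H" "iso_arcs f e = (iso_verts f u, iso_verts f v)"
        using img(2) by (metis imageE)
      then have "e = (u, v)"
        using ends[OF e(1)] arcs that inj by (auto simp: prod_eq_iff dest: inj_onD)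
      with e arcs show "(u, v) \<in> parcs \<Gamma>" by simp
    qed
    obtain a b c d where v: "a \<in> verts H" "b \<in> verts H" "c \<in> verts H" "d \<in> verts H"
      "iso_verts f a = 0" "iso_verts f b = 1" "iso_verts f c = 2" "iso_verts f d = 3"
    proof -
      have "\<exists>v \<in> verts H. iso_verts f v = i" if "i \<in> {0, 1, 2, 3}" for i
        using that img(1) by (metis imageE)
      from this[of 0] this[of 1] this[of 2] this[of 3] that show thesis by auto
    qed
    have "distinct [a, b, c, d]" using v by auto
    with v sub show ?R
      by (intro exI[of _ a] exI[of _ b] exI[of _ c] exI[of _ d]) (auto simp: adj P4_def)
  next
    assume ?R
    then obtain a b c d where dis: "distinct [a, b, c, d]" and sub: "{a, b, c, d} \<subseteq> pverts \<Gamma>"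
      and e: "(a, b) \<in> parcs \<Gamma>" "(b, c) \<in> parcs \<Gamma>" "(c, d) \<in> parcs \<Gamma>"
        "(a, c) \<notin> parcs \<Gamma>" "(a, d) \<notin> parcs \<Gamma>" "(b, d) \<notin> parcs \<Gamma>"
      by blast
    have symm: "(u, v) \<in> parcs \<Gamma> \<longleftrightarrow> (v, u) \<in> parcs \<Gamma>" for u v
      using sym_arcs by (auto simp: symmetric_def dest: symD)
    have irr: "(u, u) \<notin> parcs \<Gamma>" for u
      using no_loops by fastforce
    define H where "H = \<lparr>verts = {a, b, c, d},
      arcs = {(a, b), (b, a), (b, c), (c, b), (c, d), (d, c)}, tail = fst, head = snd\<rparr>"
    define g :: "'a \<Rightarrow> nat" where
      "g = (\<lambda>v. if v = a then 0 else if v = b then 1 else if v = c then 2 else 3)"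
    \<comment> \<open>\<open>g\<close> numbers the vertices along the path, with 3 as the default
      value that serves \<open>d\<close>. Taking the projections as end maps makes
      \<open>app_iso f H\<close> literally equal to \<open>with_proj P4\<close>.\<close>
    define f where "f = \<lparr>iso_verts = g, iso_arcs = map_prod g g,
      iso_head = (snd :: nat \<times> nat \<Rightarrow> nat), iso_tail = fst\<rparr>"
    have e': "(b, a) \<in> parcs \<Gamma>" "(c, b) \<in> parcs \<Gamma>" "(d, c) \<in> parcs \<Gamma>"
        "(c, a) \<notin> parcs \<Gamma>" "(d, a) \<notin> parcs \<Gamma>" "(d, b) \<notin> parcs \<Gamma>"
      using e by (simp_all add: symm[of b a] symm[of c b] symm[of d c] symm[of c a] symm[of d a] symm[of d b])
    have arcs: "arcs H = {x \<in> parcs \<Gamma>. fst x \<in> verts H \<and> snd x \<in> verts H}"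
    proof (rule Set.set_eqI)
      fix x :: "'a \<times> 'a"
      show "x \<in> arcs H \<longleftrightarrow> x \<in> {x \<in> parcs \<Gamma>. fst x \<in> verts H \<and> snd x \<in> verts H}"
        by (cases x) (auto simp: H_def e e' irr)
    qed
    have "wf_digraph H"
      by unfold_locales (auto simp: H_def)
    moreover have "wf_digraph (with_proj \<Gamma>)" by unfold_locales
    ultimately have "induced_subgraph H (with_proj \<Gamma>)"
      unfolding induced_subgraph_def subgraph_def compatible_def
      using sub e arcs by (simp add: H_def e')
    moreover have "pre_digraph.digraph_isomorphism H f"
      unfolding pre_digraph.digraph_isomorphism_def
      using dis \<open>wf_digraph H\<close> by (auto simp: H_def f_def g_def inj_on_def)
    moreover have "with_proj P4 = app_iso f H"
      using dis by (auto simp: app_iso_def H_def f_def g_def P4_def with_proj_def)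
    ultimately show "\<not> cograph \<Gamma>"
      unfolding cograph_def digraph_iso_def by blast
  }
qed

text \<open>A missing arc means either equal vertices or a nontrivial intersection; distinctness of
  the path vertices leaves the latter.\<close>

lemma not_cograph_intersection_subgroup_graphE:
  assumes "\<not> cograph (intersection_subgroup_graph G)"
  obtains A B C D where "subgroup A G" "subgroup B G" "subgroup C G" "subgroup D G"
    "A \<inter> B = {\<one>\<^bsub>G\<^esub>}" "B \<inter> C = {\<one>\<^bsub>G\<^esub>}" "C \<inter> D = {\<one>\<^bsub>G\<^esub>}"
    "A \<inter> C \<noteq> {\<one>\<^bsub>G\<^esub>}" "A \<inter> D \<noteq> {\<one>\<^bsub>G\<^esub>}" "B \<inter> D \<noteq> {\<one>\<^bsub>G\<^esub>}"
proof -
  let ?\<Gamma> = "intersection_subgroup_graph G"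
  obtain A B C D where dis: "distinct [A, B, C, D]" and v: "{A, B, C, D} \<subseteq> pverts ?\<Gamma>"
    and e: "(A, B) \<in> parcs ?\<Gamma>" "(B, C) \<in> parcs ?\<Gamma>" "(C, D) \<in> parcs ?\<Gamma>"
      "(A, C) \<notin> parcs ?\<Gamma>" "(A, D) \<notin> parcs ?\<Gamma>" "(B, D) \<notin> parcs ?\<Gamma>"
    using assms unfolding not_cograph_iff[OF pair_bidirected_intersection_subgroup_graph]
    by (elim exE conjE) (rule that)
  from v have v': "A \<in> isg_verts G" "B \<in> isg_verts G" "C \<in> isg_verts G" "D \<in> isg_verts G"
    by (auto simp: intersection_subgroup_graph_def)
  show thesis
  proof
    show "subgroup A G" "subgroup B G" "subgroup C G" "subgroup D G"
      using v' by (simp_all add: isg_verts_def nontrivial_subgroup_def)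
    show "A \<inter> B = {\<one>\<^bsub>G\<^esub>}" "B \<inter> C = {\<one>\<^bsub>G\<^esub>}" "C \<inter> D = {\<one>\<^bsub>G\<^esub>}"
      "A \<inter> C \<noteq> {\<one>\<^bsub>G\<^esub>}" "A \<inter> D \<noteq> {\<one>\<^bsub>G\<^esub>}" "B \<inter> D \<noteq> {\<one>\<^bsub>G\<^esub>}"
      using e v' dis by (simp_all add: intersection_subgroup_graph_def)
  qed
qed

text \<open>The six intersection conditions suffice: each subgroup occurs in a nontrivial
  intersection, so it is nontrivial, and each occurs in a trivial one, so it is a vertex. Equality
  of any two would make a trivial intersection nontrivial.\<close>

lemma not_cograph_intersection_subgroup_graphI:
  assumes s: "subgroup A G" "subgroup B G" "subgroup C G" "subgroup D G"
    and t: "A \<inter> B = {\<one>\<^bsub>G\<^esub>}" "B \<inter> C = {\<one>\<^bsub>G\<^esub>}" "C \<inter> D = {\<one>\<^bsub>G\<^esub>}"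
      "A \<inter> C \<noteq> {\<one>\<^bsub>G\<^esub>}" "A \<inter> D \<noteq> {\<one>\<^bsub>G\<^esub>}" "B \<inter> D \<noteq> {\<one>\<^bsub>G\<^esub>}"
  shows "\<not> cograph (intersection_subgroup_graph G)"
proof -
  have "K \<noteq> {\<one>\<^bsub>G\<^esub>} \<and> K' \<noteq> {\<one>\<^bsub>G\<^esub>}"
    if "K \<inter> K' \<noteq> {\<one>\<^bsub>G\<^esub>}" "subgroup K G" "subgroup K' G" for K K'
    using that subgroup.one_closed by fastforce
  then have n: "nontrivial_subgroup G A" "nontrivial_subgroup G B"
    "nontrivial_subgroup G C" "nontrivial_subgroup G D"
    unfolding nontrivial_subgroup_def using s t by metis+
  then have v: "A \<in> isg_verts G" "B \<in> isg_verts G" "C \<in> isg_verts G" "D \<in> isg_verts G"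
    unfolding isg_verts_def using t by (auto simp: Int_commute)
  have "A \<noteq> B" "A \<noteq> C" "A \<noteq> D" "B \<noteq> C" "B \<noteq> D" "C \<noteq> D"
    using t n unfolding nontrivial_subgroup_def by (metis Int_absorb Int_commute)+
  with v t show ?thesis
    unfolding not_cograph_iff[OF pair_bidirected_intersection_subgroup_graph]
    by (intro exI[of _ A] exI[of _ B] exI[of _ C] exI[of _ D])
      (simp add: intersection_subgroup_graph_def)
qed

section \<open>A group-theoretic description of the alternating group of degree 4\<close>

text \<open>If \<open>x\<close> lies outside \<open>H\<close>, then \<open>H\<close> and
  \<open>H #> x\<close> fill the group by counting. A square in the second coset would give
  \<open>x \<otimes> x = h \<otimes> x\<close>, hence \<open>x = h\<close>.\<close>

lemma (in group) square_in_index_2_subgroup: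
  assumes H: "subgroup H G" and card: "order G = 2 * card H" and fin: "finite (carrier G)"
    and x: "x \<in> carrier G"
  shows "x \<otimes> x \<in> H"
proof (cases "x \<in> H")
  case True
  with H show ?thesis by (simp add: subgroup.m_closed)
next
  case False
  have sub: "H \<subseteq> carrier G" "finite H"
    using H fin by (auto simp: subgroup.subset intro: finite_subset[OF subgroup.subset])
  have "H \<inter> (H #> x) = {}"
    using False H x sub(1) unfolding r_coset_def
    by (auto, metis subgroup.m_closed subgroup.m_inv_closed inv_solve_left' subsetD)
  moreover have "card (H #> x) = card H"
    using card_rcosets_equal[OF rcosetsI[OF sub(1) x] sub(1)] by simp
  moreover have cos: "H #> x \<subseteq> carrier G" using sub(1) x by (rule r_coset_subset_G)
  ultimately have "card (H \<union> (H #> x)) = order G"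
    using sub card fin by (simp add: card_Un_disjoint finite_subset)
  then have "H \<union> (H #> x) = carrier G"
    using card_subset_eq[OF fin, of "H \<union> (H #> x)"] sub(1) cos by (simp add: order_def)
  then consider "x \<otimes> x \<in> H" | h where "h \<in> H" "x \<otimes> x = h \<otimes> x"
    using m_closed[OF x x] unfolding r_coset_def by blast
  then show ?thesis
  proof cases
    case 2
    then have "x = h" using sub(1) x by (auto simp: subsetD)
    with 2 False show ?thesis by simp
  qed
qed

lemma (in group) subgroup_pow_card:
  assumes "subgroup H G" "x \<in> H"
  shows "x [^] card H = \<one>"
proof -
  interpret H: group "G\<lparr>carrier := H\<rparr>"
    using assms(1) by (rule subgroup.subgroup_is_group) unfold_locales
  show ?thesis
    using H.pow_order_eq_1[of x] assms(2) nat_pow_consistent[of x "card H" H]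
    by (simp add: order_def)
qed

text \<open>By Lagrange inside \<open>A\<close>, the order of \<open>A \<inter> C\<close> divides a
  prime and is not 1, so the intersection is all of \<open>A\<close>.\<close>

lemma (in group) prime_subgroup_subset:
  assumes A: "subgroup A G" and C: "subgroup C G" and p: "Factorial_Ring.prime (card A)"
    and AC: "A \<inter> C \<noteq> {\<one>}"
  shows "A \<subseteq> C"
proof -
  have finA: "finite A" using p card_ge_0_finite prime_gt_0_nat by blast
  interpret A: group "G\<lparr>carrier := A\<rparr>"
    using A by (rule subgroup.subgroup_is_group) unfold_locales
  have I: "subgroup (A \<inter> C) G" using A C by (rule subgroups_Inter_pair)
  then have IA: "subgroup (A \<inter> C) (G\<lparr>carrier := A\<rparr>)"
    using A by (intro subgroup_incl) auto
  have "card (A \<inter> C) dvd order (G\<lparr>carrier := A\<rparr>)"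
    unfolding A.lagrange[OF IA, symmetric] by (rule dvd_triv_right)
  then have "card (A \<inter> C) dvd card A" by (simp add: order_def)
  moreover have "card (A \<inter> C) \<noteq> 1"
    using AC subgroup.one_closed[OF I] by (metis card_1_singletonE singletonD)
  ultimately have "card (A \<inter> C) = card A"
    using p by (metis prime_nat_iff)
  then have "A \<inter> C = A" using finA by (intro card_subset_eq) auto
  then show ?thesis by blast
qed

text \<open>The hypotheses keep just what is needed of the alternating group: order 12, at most
  three involutions (the bound 4 counts the identity), and order 3 for all other nonidentity
  elements.\<close>

lemma (in group) cograph_intersection_subgroup_graph_order_12:
  assumes ord: "order G = 12"
    and inv: "card {x \<in> carrier G. x \<otimes> x = \<one>} \<le> 4"
    and dich: "\<And>x. x \<in> carrier G \<Longrightarrow> x \<otimes> x = \<one> \<or> x \<otimes> x \<otimes> x = \<one>"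
  shows "cograph (intersection_subgroup_graph G)"
proof (rule ccontr)
  have fin: "finite (carrier G)"
    using ord by (metis order_gt_0_iff_finite zero_less_numeral)
  assume "\<not> cograph (intersection_subgroup_graph G)"
  then obtain A B C D where s: "subgroup A G" "subgroup B G" "subgroup C G" "subgroup D G"
    and t: "A \<inter> B = {\<one>}" "B \<inter> C = {\<one>}" "C \<inter> D = {\<one>}"
      "A \<inter> C \<noteq> {\<one>}" "A \<inter> D \<noteq> {\<one>}" "B \<inter> D \<noteq> {\<one>}"
    by (rule not_cograph_intersection_subgroup_graphE)
  define V where "V = {x \<in> carrier G. x \<otimes> x = \<one>}"
  have cardV: "card V \<le> 4" using inv by (simp only: V_def)
  \<comment> \<open>An element with trivial cube equals its own fourth power, which is a square. So
    a subgroup of index 2 would contain the at least 8 elements outside \<open>V\<close>.\<close>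
  have no6: "card H \<noteq> 6" if H: "subgroup H G" for H
  proof
    assume c: "card H = 6"
    have "carrier G - V \<subseteq> H"
    proof
      fix x assume x: "x \<in> carrier G - V"
      then have xc: "x \<in> carrier G" and 3: "x \<otimes> x \<otimes> x = \<one>"
        using dich by (auto simp: V_def)
      have "(x \<otimes> x) \<otimes> (x \<otimes> x) \<in> H"
        using square_in_index_2_subgroup[OF H _ fin, of "x"] xc H c ord
        by (simp add: subgroup.m_closed)
      also have "(x \<otimes> x) \<otimes> (x \<otimes> x) = (x \<otimes> x \<otimes> x) \<otimes> x"
        using xc by (simp add: m_assoc)
      also have "\<dots> = x" using xc 3 by simp
      finally show "x \<in> H" .
    qed
    moreover have "finite H" using c card_ge_0_finite[of H] by simp
    ultimately have "card (carrier G - V) \<le> 6" using c card_mono by metis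
    moreover have "card (carrier G - V) = 12 - card V"
      using ord fin by (subst card_Diff_subset) (auto simp: V_def order_def)
    ultimately show False using cardV by linarith
  qed
  \<comment> \<open>\<open>K'\<close> serves to make \<open>K\<close> proper. Among the divisors of
    12 only 4 survives; then fourth powers in \<open>K\<close> are trivial, which together with a
    trivial cube would force the identity, so \<open>K\<close> lies in \<open>V\<close> and fills it
    by counting.\<close>
  have klein: "K = V"
    if K: "subgroup K G" and K': "subgroup K' G" "K \<inter> K' = {\<one>}" "K' \<noteq> {\<one>}"
      and np: "\<not> Factorial_Ring.prime (card K)" and nt: "K \<noteq> {\<one>}" for K K'
  proof -
    have "card K dvd 12" using lagrange[OF K] ord by (metis dvd_triv_right)
    then have "card K \<in> {1, 2, 3, 4, 6, 12}"
    proof -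
      have "card K \<le> 12" using \<open>card K dvd 12\<close> by (simp add: dvd_imp_le)
      then have "card K = 0 \<or> card K = 1 \<or> card K = 2 \<or> card K = 3 \<or> card K = 4 \<or> card K = 5 \<or>
        card K = 6 \<or> card K = 7 \<or> card K = 8 \<or> card K = 9 \<or> card K = 10 \<or> card K = 11 \<or> card K = 12"
        by presburger
      then show ?thesis using \<open>card K dvd 12\<close> by (elim disjE) simp_all
    qed
    moreover have "card K \<noteq> 1"
      using nt subgroup.one_closed[OF K] by (metis card_1_singletonE singletonD)
    moreover have "card K \<noteq> 2" "card K \<noteq> 3"
      using np by auto
    moreover have "card K \<noteq> 12"
    proof
      assume "card K = 12"
      then have "K = carrier G"
        using ord fin K by (intro card_subset_eq) (auto simp: order_def subgroup.subset)
      with K' show False using subgroup.subset[OF K'(1)] by blast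
    qed
    ultimately have c: "card K = 4" using no6[OF K] by auto
    have "K \<subseteq> V"
    proof
      fix x assume x: "x \<in> K"
      then have xc: "x \<in> carrier G" using K subgroup.subset by blast
      have "x [^] (4::nat) = \<one>" using subgroup_pow_card[OF K x] c by simp
      then have 4: "x \<otimes> x \<otimes> x \<otimes> x = \<one>" using xc by (simp add: numeral_eq_Suc)
      show "x \<in> V"
        using dich[OF xc] 4 xc by (auto simp: V_def)
    qed
    then show "K = V"
      using c cardV fin by (intro card_seteq) (simp_all add: V_def)
  qed
  have ne: "K \<noteq> {\<one>}" if "K \<inter> K' \<noteq> {\<one>}" "subgroup K' G" for K K'
    using that by (auto dest: subgroup.one_closed)
  have nt: "A \<noteq> {\<one>}" "B \<noteq> {\<one>}" "C \<noteq> {\<one>}" "D \<noteq> {\<one>}"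
    using ne[OF t(4) s(3)] ne[OF t(6) s(4)] ne[OF t(4)[unfolded Int_commute[of A]] s(1)]
      ne[OF t(5)[unfolded Int_commute[of A]] s(1)] by simp_all
  \<comment> \<open>A subgroup of prime order would be contained in both \<open>L\<close> and
    \<open>M\<close>, which meet trivially. This is applied to \<open>A\<close> with
    \<open>C\<close>, \<open>D\<close> and to \<open>D\<close> with \<open>A\<close>,
    \<open>B\<close>.\<close>
  have not_prime: "\<not> Factorial_Ring.prime (card K)"
    if "subgroup K G" "subgroup L G" "subgroup M G" "K \<inter> L \<noteq> {\<one>}" "K \<inter> M \<noteq> {\<one>}"
      "L \<inter> M = {\<one>}" "K \<noteq> {\<one>}" for K L M
  proof
    assume p: "Factorial_Ring.prime (card K)"
    have "K \<subseteq> L" "K \<subseteq> M"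
      using prime_subgroup_subset[OF that(1,2) p that(4)]
        prime_subgroup_subset[OF that(1,3) p that(5)] by simp_all
    then have "K \<subseteq> {\<one>}" using that(6) by (metis Int_greatest)
    with that(7) show False
      using subgroup.one_closed[OF that(1)] by (metis subset_singletonD empty_iff)
  qed
  have "A = V"
    using klein[OF s(1,2) t(1) nt(2) not_prime[OF s(1,3,4) t(4,5,3) nt(1)] nt(1)] .
  moreover have "D = V"
  proof (rule klein[OF s(4,3) _ nt(3) not_prime[OF s(4,1,2) _ _ t(1) nt(4)] nt(4)])
    show "D \<inter> C = {\<one>}" "D \<inter> A \<noteq> {\<one>}" "D \<inter> B \<noteq> {\<one>}"
      using t(3,5,6) by (simp_all add: Int_commute)
  qed
  ultimately show False using t(1,6) by (metis Int_commute)
qed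

section \<open>Two-by-two matrices\<close>

text \<open>Naming the entries lets the simplifier turn matrix equations into polynomial identities
  in the field.\<close>

definition mat2 :: "'k::field \<Rightarrow> 'k \<Rightarrow> 'k \<Rightarrow> 'k \<Rightarrow> 'k ^ 2 ^ 2" where
  "mat2 a b c d = vector [vector [a, b], vector [c, d]]"

lemma mat2_nth [simp]:
  "mat2 a b c d $ 1 $ 1 = a" "mat2 a b c d $ 1 $ 2 = b"
  "mat2 a b c d $ 2 $ 1 = c" "mat2 a b c d $ 2 $ 2 = d"
  by (simp_all add: mat2_def)

lemma mat2_cases: obtains a b c d where "M = mat2 a b c d"
proof
  show "M = mat2 (M $ 1 $ 1) (M $ 1 $ 2) (M $ 2 $ 1) (M $ 2 $ 2)"
    by (simp add: vec_eq_iff forall_2)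
qed

lemma mat2_eq_iff [simp]:
  "mat2 a b c d = mat2 a' b' c' d' \<longleftrightarrow> a = a' \<and> b = b' \<and> c = c' \<and> d = d'"
  by (auto simp: vec_eq_iff forall_2)

lemma mat2_mult [simp]:
  "mat2 a b c d ** mat2 a' b' c' d' =
     mat2 (a * a' + b * c') (a * b' + b * d') (c * a' + d * c') (c * b' + d * d')"
  by (simp add: vec_eq_iff forall_2 matrix_matrix_mult_def sum_2)

lemma det_mat2 [simp]: "det (mat2 a b c d) = a * d - b * c"
  by (simp add: det_2)

lemma uminus_mat2 [simp]: "- mat2 a b c d = mat2 (- a) (- b) (- c) (- d)"
  by (simp add: vec_eq_iff forall_2)

lemma mat_1_mat2: "mat 1 = mat2 1 0 0 1"
  by (simp add: vec_eq_iff forall_2 mat_def)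

section \<open>The special linear group of degree 2 and its centre\<close>

lemma carrier_SL: "carrier SL = {A. det A = 1}"
  and mult_SL: "mult SL = (**)"
  and one_SL: "one SL = mat 1"
  by (simp_all add: SL_def)

lemma mat2_in_SL_iff [simp]: "mat2 a b c d \<in> carrier SL \<longleftrightarrow> a * d - b * c = 1"
  by (simp add: carrier_SL)

lemma SL2_cases:
  assumes "M \<in> carrier SL"
  obtains a b c d where "M = mat2 a b c d" "a * d - b * c = 1"
  using assms by (metis mat2_cases mat2_in_SL_iff)

text \<open>Commuting with the two elementary transvections forces a scalar matrix, and determinant
  1 forces the scalar to have square 1.\<close>

lemma group_center_SL2: "group_center (SL :: ('k::field ^ 2 ^ 2) monoid) = {mat 1, - mat 1}"
proof
  show "group_center (SL :: ('k ^ 2 ^ 2) monoid) \<subseteq> {mat 1, - mat 1}"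
  proof
    fix z :: "'k ^ 2 ^ 2" assume "z \<in> group_center SL"
    then have zc: "z \<in> carrier SL" and comm: "\<And>x. x \<in> carrier SL \<Longrightarrow> z ** x = x ** z"
      by (auto simp: group_center_def mult_SL)
    obtain a b c d where z: "z = mat2 a b c d" "a * d - b * c = 1"
      using zc by (rule SL2_cases)
    have "c = 0" "a = d" using comm[of "mat2 1 1 0 1"] z by auto
    moreover have "b = 0" using comm[of "mat2 1 0 1 1"] z by auto
    ultimately show "z \<in> {mat 1, - mat 1}"
      using z by (auto simp: mat_1_mat2 square_eq_1_iff)
  qed
  show "{mat 1, - mat 1} \<subseteq> group_center (SL :: ('k ^ 2 ^ 2) monoid)"
    by (auto simp: group_center_def mult_SL mat_1_mat2 elim!: SL2_cases)
qed

lemma inv_SL2: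
  assumes "a * d - b * c = 1"
  shows "inv\<^bsub>SL\<^esub> (mat2 a b c d) = mat2 d (- b) (- c) a"
  using assms by (intro group.inv_equality[OF group_SL])
    (auto simp: mult_SL one_SL mat_1_mat2 algebra_simps)

text \<open>Follows the coset map by an isomorphism onto \<open>G\<close>. Since the centre is plus
  or minus the identity, all later work in \<open>G\<close> becomes computation with matrices up to
  sign.\<close>

lemma PSL2_projection:
  fixes G :: "('g, 'm) monoid_scheme"
  assumes "group G" "G \<cong> (PSL :: ('k::field ^ 2 ^ 2) set monoid)"
  obtains \<pi> where "group_hom (SL :: ('k ^ 2 ^ 2) monoid) G \<pi>"
    "\<pi> ` carrier SL = carrier G"
    "\<And>M N. M \<in> carrier SL \<Longrightarrow> N \<in> carrier SL \<Longrightarrow> \<pi> M = \<pi> N \<longleftrightarrow> M = N \<or> M = - N"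
proof -
  let ?S = "SL :: ('k ^ 2 ^ 2) monoid"
  let ?Z = "group_center ?S"
  interpret S: group ?S by (rule group_SL)
  interpret Z: normal ?Z ?S by (rule normal_group_center) (rule group_SL)
  obtain h where h: "h \<in> hom (PSL :: ('k ^ 2 ^ 2) set monoid) G" "bij_betw h (carrier PSL) (carrier G)"
    using group.iso_sym[OF assms] by (auto simp: is_iso_def iso_def)
  have carr: "carrier PSL = rcosets\<^bsub>?S\<^esub> ?Z" by (simp add: PSL_def FactGroup_def)
  define \<pi> where "\<pi> = h \<circ> (\<lambda>M. ?Z #>\<^bsub>?S\<^esub> M)"
  show thesis
  proof
    have "\<pi> \<in> hom ?S G"
      unfolding \<pi>_def using Z.r_coset_hom_Mod h(1) unfolding PSL_def by (rule hom_compose)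
    then show "group_hom ?S G \<pi>"
      using assms(1) by (simp add: group_hom_def group_hom_axioms_def S.is_group)
    have "(\<lambda>M. ?Z #>\<^bsub>?S\<^esub> M) ` carrier ?S = carrier PSL"
      by (auto simp: carr RCOSETS_def)
    then show "\<pi> ` carrier ?S = carrier G"
      unfolding \<pi>_def image_comp[symmetric] using h(2) by (simp add: bij_betw_def)
    fix M N assume MN: "M \<in> carrier ?S" "N \<in> carrier ?S"
    have "\<pi> M = \<pi> N \<longleftrightarrow> ?Z #>\<^bsub>?S\<^esub> M = ?Z #>\<^bsub>?S\<^esub> N"
      unfolding \<pi>_def using MN h(2)
      by (auto simp: bij_betw_def carr RCOSETS_def dest!: inj_onD)
    also have "\<dots> \<longleftrightarrow> M \<in> ?Z #>\<^bsub>?S\<^esub> N"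
      using MN S.repr_independence[OF _ MN(2) Z.is_subgroup]
        S.repr_independenceD[OF Z.is_subgroup MN(1)] by blast
    also have "\<dots> \<longleftrightarrow> M = N \<or> M = - N"
      unfolding r_coset_def group_center_SL2
      by (cases N rule: mat2_cases) (auto simp: mult_SL mat_1_mat2)
    finally show "\<pi> M = \<pi> N \<longleftrightarrow> M = N \<or> M = - N" .
  qed
qed

lemma order_PSL2:
  assumes "(1 :: 'k::field) \<noteq> - 1"
  shows "2 * order (PSL :: ('k ^ 2 ^ 2) set monoid) = order (SL :: ('k ^ 2 ^ 2) monoid)"
proof -
  have "card (group_center (SL :: ('k ^ 2 ^ 2) monoid)) = 2"
    using assms by (simp add: group_center_SL2 mat_1_mat2)
  then show ?thesis
    using group.lagrange[OF group_SL
        normal_imp_subgroup[OF normal_group_center[OF group_SL[where 'k='k and 'n=2]]]]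
    by (simp add: PSL_def FactGroup_def order_def mult.commute)
qed

section \<open>The projective special linear groups\<close>

text \<open>Otherwise the characteristic would be 2, and the characteristic divides the number of
  elements.\<close>

lemma one_neq_minus_one_if_odd_card:
  assumes "odd CARD('k::{field,finite})"
  shows "(1 :: 'k) \<noteq> - 1"
proof
  assume "(1 :: 'k) = - 1"
  then have "of_nat 2 = (0 :: 'k)" by (simp add: eq_neg_iff_add_eq_0)
  then have "CHAR('k) dvd 2" by (simp only: of_nat_eq_0_iff_char_dvd)
  moreover have "CHAR('k) \<noteq> 1" by simp
  ultimately have "CHAR('k) = 2"
    by (metis prime_nat_iff two_is_prime_nat)
  with assms show False using CHAR_dvd_CARD[where 'a = 'k] by simp
qed

section \<open>Triangular subgroups and the induced path\<close>

text \<open>Reduces the subgroup axioms to conditions on entries: \<open>inv\<close> is closure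
  under the adjugate, which is the inverse at determinant 1, and \<open>mult\<close> is closure
  under the product formula.\<close>

lemma subgroup_SL2I:
  fixes P :: "'k::field \<Rightarrow> 'k \<Rightarrow> 'k \<Rightarrow> 'k \<Rightarrow> bool"
  assumes one: "P 1 0 0 1"
    and inv: "\<And>a b c d. a * d - b * c = 1 \<Longrightarrow> P a b c d \<Longrightarrow> P d (- b) (- c) a"
    and mult: "\<And>a b c d a' b' c' d'. a * d - b * c = 1 \<Longrightarrow> a' * d' - b' * c' = 1 \<Longrightarrow>
      P a b c d \<Longrightarrow> P a' b' c' d' \<Longrightarrow>
      P (a * a' + b * c') (a * b' + b * d') (c * a' + d * c') (c * b' + d * d')"
  shows "subgroup {mat2 a b c d |a b c d. a * d - b * c = 1 \<and> P a b c d} SL"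
proof (rule group.subgroupI[OF group_SL])
  let ?S = "{mat2 a b c d |a b c d. a * d - b * c = 1 \<and> P a b c d}"
  show "?S \<subseteq> carrier SL" by auto
  have "mat2 1 0 0 1 \<in> ?S" using one by simp
  then show "?S \<noteq> {}" by blast
  fix M assume "M \<in> ?S"
  then obtain a b c d where M: "M = mat2 a b c d" "a * d - b * c = 1" "P a b c d" by blast
  then show "inv\<^bsub>SL\<^esub> M \<in> ?S" using inv by (simp add: inv_SL2 mult.commute)
  fix N assume "N \<in> ?S"
  then obtain a' b' c' d' where N: "N = mat2 a' b' c' d'" "a' * d' - b' * c' = 1" "P a' b' c' d'"
    by blast
  \<comment> \<open>Closure of \<open>SL\<close> supplies the determinant condition for the product
    without expanding it.\<close>
  have "M \<otimes>\<^bsub>SL\<^esub> N \<in> carrier SL"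
    using M N by (intro monoid.m_closed[OF group.is_monoid[OF group_SL]]) auto
  then show "M \<otimes>\<^bsub>SL\<^esub> N \<in> ?S" using M N mult by (simp add: mult_SL)
qed

text \<open>Works over any field: all that is needed is a \<open>t\<close> whose diagonal matrix
  with entries \<open>t\<close> and \<open>inverse t\<close> differs from plus and minus the
  identity.\<close>

lemma not_cograph_PSL2:
  fixes G :: "('g, 'm) monoid_scheme" and t :: "'k::field"
  assumes "group G" "G \<cong> (PSL :: ('k ^ 2 ^ 2) set monoid)"
    and t: "t \<notin> {0, 1, - 1}"
  shows "\<not> cograph (intersection_subgroup_graph G)"
proof -
  obtain \<pi> where hom: "group_hom (SL :: ('k ^ 2 ^ 2) monoid) G \<pi>"
    and eq: "\<And>M N. M \<in> carrier SL \<Longrightarrow> N \<in> carrier SL \<Longrightarrow> \<pi> M = \<pi> N \<longleftrightarrow> M = N \<or> M = - N"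
    using PSL2_projection[OF assms(1,2)] by metis
  have one: "\<pi> (mat2 1 0 0 1) = \<one>\<^bsub>G\<^esub>"
    using group_hom.hom_one[OF hom] by (simp add: one_SL mat_1_mat2)
  define S where "S P = {mat2 a b c d |a b c d. a * d - b * c = 1 \<and> P a b c d}"
    for P :: "'k \<Rightarrow> 'k \<Rightarrow> 'k \<Rightarrow> 'k \<Rightarrow> bool"
  define U where "U = S (\<lambda>a b c d. c = 0)"
  define U1 where "U1 = S (\<lambda>a b c d. c = 0 \<and> a = 1 \<and> d = 1)"
  define L where "L = S (\<lambda>a b c d. b = 0)"
  define L1 where "L1 = S (\<lambda>a b c d. b = 0 \<and> a = 1 \<and> d = 1)"
  have "subgroup U SL" "subgroup L1 SL" "subgroup U1 SL" "subgroup L SL"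
    unfolding U_def U1_def L_def L1_def S_def by (rule subgroup_SL2I; simp)+
  then have sub: "subgroup (\<pi> ` U) G" "subgroup (\<pi> ` L1) G" "subgroup (\<pi> ` U1) G" "subgroup (\<pi> ` L) G"
    using group_hom.subgroup_img_is_subgroup[OF hom] by blast+
  \<comment> \<open>Images can meet although the matrices differ by a sign, so triviality is tested
    up to sign. The test is asymmetric: the matrix from \<open>K'\<close> must be the identity
    itself.\<close>
  have meet: "\<pi> ` K \<inter> \<pi> ` K' = {\<one>\<^bsub>G\<^esub>}"
    if "K \<subseteq> carrier SL" "K' \<subseteq> carrier SL" "mat2 1 0 0 1 \<in> K" "mat2 1 0 0 1 \<in> K'"
      "\<And>M N. M \<in> K \<Longrightarrow> N \<in> K' \<Longrightarrow> M = N \<or> M = - N \<Longrightarrow> N = mat2 1 0 0 1" for K K'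
  proof
    show "{\<one>\<^bsub>G\<^esub>} \<subseteq> \<pi> ` K \<inter> \<pi> ` K'" using that(3,4) one by force
    show "\<pi> ` K \<inter> \<pi> ` K' \<subseteq> {\<one>\<^bsub>G\<^esub>}"
    proof
      fix x assume "x \<in> \<pi> ` K \<inter> \<pi> ` K'"
      then obtain M N where MN: "M \<in> K" "N \<in> K'" "x = \<pi> M" "x = \<pi> N" by auto
      then have "M = N \<or> M = - N" using eq[of M N] that(1,2) by auto
      with MN have "N = mat2 1 0 0 1" using that(5) by blast
      with MN one show "x \<in> {\<one>\<^bsub>G\<^esub>}" by simp
    qed
  qed
  have nontriv: "\<pi> ` K \<inter> \<pi> ` K' \<noteq> {\<one>\<^bsub>G\<^esub>}"
    if "M \<in> K \<inter> K'" "M \<in> carrier SL" "M \<noteq> mat2 1 0 0 1" "M \<noteq> mat2 (- 1) 0 0 (- 1)" for K K' M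
  proof -
    have "\<pi> M \<noteq> \<one>\<^bsub>G\<^esub>" using eq[of M "mat2 1 0 0 1"] that one by simp
    with that show ?thesis by blast
  qed
  note defs = U_def U1_def L_def L1_def S_def
  show ?thesis
  proof (rule not_cograph_intersection_subgroup_graphI[OF sub])
    show "\<pi> ` U \<inter> \<pi> ` L1 = {\<one>\<^bsub>G\<^esub>}" by (rule meet) (auto simp: defs)
    show "\<pi> ` L1 \<inter> \<pi> ` U1 = {\<one>\<^bsub>G\<^esub>}" by (rule meet) (auto simp: defs)
    \<comment> \<open>The unitriangular group has to come second for \<open>meet\<close>, because
      \<open>L\<close> also contains minus the identity.\<close>
    have "\<pi> ` L \<inter> \<pi> ` U1 = {\<one>\<^bsub>G\<^esub>}" by (rule meet) (auto simp: defs)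
    then show "\<pi> ` U1 \<inter> \<pi> ` L = {\<one>\<^bsub>G\<^esub>}" by (simp add: Int_commute)
    show "\<pi> ` U \<inter> \<pi> ` U1 \<noteq> {\<one>\<^bsub>G\<^esub>}"
      by (rule nontriv[of "mat2 1 1 0 1"]) (auto simp: defs)
    show "\<pi> ` L1 \<inter> \<pi> ` L \<noteq> {\<one>\<^bsub>G\<^esub>}"
      by (rule nontriv[of "mat2 1 0 1 1"]) (auto simp: defs)
    show "\<pi> ` U \<inter> \<pi> ` L \<noteq> {\<one>\<^bsub>G\<^esub>}"
      using t by (intro nontriv[of "mat2 t 0 0 (inverse t)"]) (auto simp: defs)
  qed
qed

section \<open>The field with three elements\<close>

lemma UNIV_card_3:
  assumes "CARD('k::{field,finite}) = 3"
  shows "(UNIV :: 'k set) = {0, 1, - 1}" "(1 :: 'k) \<noteq> - 1" "(2 :: 'k) = - 1"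
proof -
  show 1: "(1 :: 'k) \<noteq> - 1"
    using assms by (intro one_neq_minus_one_if_odd_card) simp
  then have "card {0, 1, - 1 :: 'k} = CARD('k)" using assms by simp
  then show U: "(UNIV :: 'k set) = {0, 1, - 1}"
    using card_subset_eq[of UNIV "{0, 1, - 1 :: 'k}"] by simp
  have "(2 :: 'k) \<noteq> 0" using 1 by (simp add: eq_neg_iff_add_eq_0)
  moreover have "(2 :: 'k) \<noteq> 1" by (metis add_cancel_right_left one_add_one one_neq_zero)
  ultimately show "(2 :: 'k) = - 1" using U by blast
qed

text \<open>The hypotheses of the order 12 criterion are checked by running through all matrices
  over the three-element field and passing to \<open>G\<close> up to sign.\<close>

lemma cograph_PSL2_3:
  fixes G :: "('g, 'm) monoid_scheme"
  assumes q: "CARD('k::{field,finite}) = 3"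
    and "group G" "G \<cong> (PSL :: ('k ^ 2 ^ 2) set monoid)"
  shows "cograph (intersection_subgroup_graph G)"
proof -
  note U = UNIV_card_3(1)[OF q] and neq = UNIV_card_3(2)[OF q] and two = UNIV_card_3(3)[OF q]
  have neq': "- 1 \<noteq> (1 :: 'k)" using neq by metis
  \<comment> \<open>Sums of ones are collected into numerals by the simplifier; these equations
    bring them back to 0, 1 and -1.\<close>
  have three: "(3 :: 'k) = 0" using two by (metis add.left_inverse numeral_plus_one semiring_norm(5))
  have four: "(4 :: 'k) = 1"
    using three by (metis add_0 numeral_plus_one semiring_norm(2) semiring_norm(8))
  note arith = neq neq' two three four
  have all_F3: "(\<forall>x :: 'k. P x) \<longleftrightarrow> P 0 \<and> P 1 \<and> P (- 1)" for P
    using U by (metis (full_types) UNIV_I insertE singletonD)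
  define E where "E = [0, 1, - 1 :: 'k]"
  \<comment> \<open>A list of the quadruples of determinant 1, so that the order of
    \<open>SL\<close> is found by evaluating a length.\<close>
  define Q where "Q = filter (\<lambda>(a, b, c, d). a * d - b * c = 1)
    (List.product E (List.product E (List.product E E)))"
  have "set E = UNIV" using U by (simp add: E_def)
  then have "set Q = {(a, b, c, d). a * d - b * c = 1}" by (auto simp: Q_def)
  then have "carrier (SL :: ('k ^ 2 ^ 2) monoid) = (\<lambda>(a, b, c, d). mat2 a b c d) ` set Q"
    by (auto simp: image_iff elim!: SL2_cases)
  moreover have "inj_on (\<lambda>(a, b, c, d). mat2 a b c d) (set Q)"
    by (auto simp: inj_on_def)
  ultimately have "order (SL :: ('k ^ 2 ^ 2) monoid) = card (set Q)"
    by (simp add: order_def card_image)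
  also have "\<dots> = length Q"
    unfolding Q_def by (intro distinct_card distinct_filter distinct_product) (simp_all add: E_def neq)
  also have "\<dots> = 24"
    by (simp add: Q_def E_def arith)
  finally have "order (SL :: ('k ^ 2 ^ 2) monoid) = 24" .
  then have ord: "order G = 12"
    using order_PSL2[OF neq] iso_same_card[OF assms(3)] by (simp add: order_def)
  obtain \<pi> where hom: "group_hom (SL :: ('k ^ 2 ^ 2) monoid) G \<pi>"
    and surj: "\<pi> ` carrier SL = carrier G"
    and eq: "\<And>M N. M \<in> carrier SL \<Longrightarrow> N \<in> carrier SL \<Longrightarrow> \<pi> M = \<pi> N \<longleftrightarrow> M = N \<or> M = - N"
    using PSL2_projection[OF assms(2,3)] by metis
  interpret group_hom "SL :: ('k ^ 2 ^ 2) monoid" G \<pi> by (rule hom)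
  have one: "\<pi> M = \<one>\<^bsub>G\<^esub> \<longleftrightarrow> M = mat2 1 0 0 1 \<or> M = mat2 (- 1) 0 0 (- 1)" if "M \<in> carrier SL" for M
    using eq[OF that, of "mat2 1 0 0 1"] hom_one by (simp add: one_SL mat_1_mat2)
  \<comment> \<open>One matrix from each sign pair in the quaternion subgroup of order 8: the
    identity and three matrices of trace 0.\<close>
  let ?R = "{mat2 1 0 0 1, mat2 0 1 (- 1) 0, mat2 1 1 1 (- 1), mat2 1 (- 1) (- 1) (- 1) :: 'k ^ 2 ^ 2}"
  have square_root: "\<forall>a b c d :: 'k. a * d - b * c = 1 \<longrightarrow>
      mat2 a b c d ** mat2 a b c d \<in> {mat2 1 0 0 1, mat2 (- 1) 0 0 (- 1)} \<longrightarrow>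
      (\<exists>N \<in> ?R. mat2 a b c d = N \<or> mat2 a b c d = - N)"
    by (simp add: all_F3 arith)
  \<comment> \<open>Checked by enumeration; Cayley-Hamilton explains it. Trace 0 makes the square
    minus the identity, and a trace of 1 or -1 makes the cube minus that trace times the
    identity.\<close>
  have power: "\<forall>a b c d :: 'k. a * d - b * c = 1 \<longrightarrow>
      mat2 a b c d ** mat2 a b c d \<in> {mat2 1 0 0 1, mat2 (- 1) 0 0 (- 1)} \<or>
      mat2 a b c d ** mat2 a b c d ** mat2 a b c d \<in> {mat2 1 0 0 1, mat2 (- 1) 0 0 (- 1)}"
    by (simp add: all_F3 arith)
  have "{x \<in> carrier G. x \<otimes>\<^bsub>G\<^esub> x = \<one>\<^bsub>G\<^esub>} \<subseteq> \<pi> ` ?R"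
  proof
    fix x assume x: "x \<in> {x \<in> carrier G. x \<otimes>\<^bsub>G\<^esub> x = \<one>\<^bsub>G\<^esub>}"
    then obtain M where M: "M \<in> carrier SL" "x = \<pi> M" using surj by blast
    then have "\<pi> (M ** M) = \<one>\<^bsub>G\<^esub>" using x hom_mult[of M M] by (simp add: mult_SL)
    then have sq: "M ** M = mat2 1 0 0 1 \<or> M ** M = mat2 (- 1) 0 0 (- 1)"
      using one[of "M ** M"] M G.m_closed[of M M] by (simp add: mult_SL)
    obtain a b c d where abcd: "M = mat2 a b c d" "a * d - b * c = 1" using M(1) by (rule SL2_cases)
    have "\<exists>N \<in> ?R. M = N \<or> M = - N"
      using square_root abcd sq by (metis insert_iff)
    then obtain N where "N \<in> ?R" "M = N \<or> M = - N" by blast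
    moreover from this have "N \<in> carrier SL" by (auto simp: arith)
    ultimately show "x \<in> \<pi> ` ?R" using eq[OF M(1), of N] M(2) by blast
  qed
  then have "card {x \<in> carrier G. x \<otimes>\<^bsub>G\<^esub> x = \<one>\<^bsub>G\<^esub>} \<le> card (\<pi> ` ?R)"
    by (intro card_mono) auto
  also have "\<dots> \<le> card ?R" by (intro card_image_le) simp
  also have "\<dots> \<le> 4" by (simp add: card_insert_if)
  finally have inv: "card {x \<in> carrier G. x \<otimes>\<^bsub>G\<^esub> x = \<one>\<^bsub>G\<^esub>} \<le> 4" .
  have dich: "x \<otimes>\<^bsub>G\<^esub> x = \<one>\<^bsub>G\<^esub> \<or> x \<otimes>\<^bsub>G\<^esub> x \<otimes>\<^bsub>G\<^esub> x = \<one>\<^bsub>G\<^esub>" if x: "x \<in> carrier G" for x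
  proof -
    obtain M where M: "M \<in> carrier SL" "x = \<pi> M" using x surj by blast
    obtain a b c d where abcd: "M = mat2 a b c d" "a * d - b * c = 1" using M(1) by (rule SL2_cases)
    have "M ** M \<in> {mat2 1 0 0 1, mat2 (- 1) 0 0 (- 1)} \<or>
      M ** M ** M \<in> {mat2 1 0 0 1, mat2 (- 1) 0 0 (- 1)}"
      using power[rule_format, OF abcd(2)] unfolding abcd(1) .
    moreover have sq: "M ** M \<in> carrier SL"
      using G.m_closed[OF M(1) M(1)] by (simp add: mult_SL)
    moreover have "M ** M ** M \<in> carrier SL"
      using G.m_closed[OF sq M(1)] by (simp add: mult_SL)
    ultimately have "\<pi> (M ** M) = \<one>\<^bsub>G\<^esub> \<or> \<pi> (M ** M ** M) = \<one>\<^bsub>G\<^esub>"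
      using one by blast
    then show ?thesis
      using M sq hom_mult[of M M] hom_mult[of "M ** M" M] by (simp add: mult_SL)
  qed
  show ?thesis
    using assms(2) ord inv dich by (rule group.cograph_intersection_subgroup_graph_order_12)
qed

theorem theorem8p4:
  fixes G :: "('g, 'm) monoid_scheme"
    and p f q :: nat
  assumes "Factorial_Ring.prime p" and "odd p" and "f \<ge> 1" and "q = p ^ f"
    and "CARD('k::{field,finite}) = q"
    and "group G"
    and "G \<cong> (PSL :: ('k ^ 2 ^ 2) set monoid)"
  shows "cograph (intersection_subgroup_graph G) \<longleftrightarrow> q = 3"
proof
  assume "q = 3"
  then show "cograph (intersection_subgroup_graph G)"
    using assms(5-7) by (intro cograph_PSL2_3[where 'k = 'k]) simp_all
next
  assume cog: "cograph (intersection_subgroup_graph G)"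
  have "odd q" using assms(2,4) by simp
  then have "(1 :: 'k) \<noteq> - 1"
    using assms(5) by (intro one_neq_minus_one_if_odd_card) simp
  then have "card {0, 1, - 1 :: 'k} = 3" by simp
  moreover have "UNIV = {0, 1, - 1 :: 'k}"
    using cog not_cograph_PSL2[OF assms(6,7)] by blast
  ultimately show "q = 3" using assms(5) by simp
qed

end
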